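(* Let $D_0$ be a northeast diagram with super-standard labeling $\mathcal{L}_0$. Then a diagram $D$ lies in $\mathcal{P}(D_0)$ if and only if $D$ admits a northeast labeling $\mathcal{L}$ that is column-equivalent to $\mathcal{L}_0$.
   Context: A diagram is a finite subset of $\mathbb{N}\times\mathbb{N}$; $(r,c)$ is a cell in row $r$, column $c$, rows numbered bottom to top. A Kohnert move on $D$ takes the rightmost cell $(r,c)$ of some row and moves it to $(r',c)$, $r'$ the largest $1\le r'<r$ with $(r',c)\notin D$ (no move if none). $\mathcal{P}(D_0)$ is the set of diagrams obtainable from $D_0$ by finitely many Kohnert moves. $D$ is northeast if for all cells $(r_1,c_1),(r_2,c_2)\in D$, $(\max(r_1,r_2),\max(c_1,c_2))\in D$. A labeling of $D$ is a map $\mathcal{L}:D\to\mathbb{N}$; it is strict if labels strictly increase from bottom to top within each column; the super-standard labeling labels each cell by its row index. For a strict labeling, the column content is the sequence $(C_1,C_2,\dots)$ with $C_i$ the set of labels in column $i$; two labelings are column-equivalent if they have the same column content. A northeast labeling of $D$ is a labeling $\mathcal{L}$ such that: (1) $\mathcal{L}$ is strict; (2) each label in row $i$ is at least $i$; (3) if cell $x'$ is in a column strictly to the right of cell $x$ and $\mathcal{L}(x')<\mathcal{L}(x)$, then there is a cell $x''$ in the column of $x'$ with $\mathcal{L}(x'')=\mathcal{L}(x)$; (4) if $x'$ is in a column strictly to the right of $x$ and $\mathcal{L}(x')=\mathcal{L}(x)$, then $x'$ is weakly below $x$. *)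

theory Defs
  imports Main
begin

text \<open>
  A cell \<open>(r, c)\<close> lies in row \<open>r\<close> (counted from bottom to top) and column \<open>c\<close>. The natural numbers
  indexing rows and columns, and serving as labels, are positive: row 1 is the bottom row, below
  which no cell can move.
\<close>

type_synonym cell = "nat \<times> nat"

definition diagram :: "cell set \<Rightarrow> bool" where
  "diagram D \<longleftrightarrow> finite D \<and> (\<forall>(r, c) \<in> D. 1 \<le> r \<and> 1 \<le> c)"

definition northeast :: "cell set \<Rightarrow> bool" where
  "northeast D \<longleftrightarrow>
    (\<forall>r1 c1 r2 c2. (r1, c1) \<in> D \<and> (r2, c2) \<in> D \<longrightarrow> (max r1 r2, max c1 c2) \<in> D)"

definition rightmost_in_row :: "cell set \<Rightarrow> nat \<Rightarrow> nat \<Rightarrow> bool" where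
  "rightmost_in_row D r c \<longleftrightarrow> (r, c) \<in> D \<and> (\<forall>c'. (r, c') \<in> D \<longrightarrow> c' \<le> c)"

definition empty_rows_below :: "cell set \<Rightarrow> nat \<Rightarrow> nat \<Rightarrow> nat set" where
  "empty_rows_below D r c = {s. 1 \<le> s \<and> s < r \<and> (s, c) \<notin> D}"

definition kohnert_move :: "cell set \<Rightarrow> cell set \<Rightarrow> bool" where
  "kohnert_move D D' \<longleftrightarrow>
    (\<exists>r c r'. rightmost_in_row D r c \<and>
      r' \<in> empty_rows_below D r c \<and> (\<forall>s \<in> empty_rows_below D r c. s \<le> r') \<and>
      D' = insert (r', c) (D - {(r, c)}))"

definition kohnert_diagrams :: "cell set \<Rightarrow> cell set set" where
  "kohnert_diagrams D0 = {D. kohnert_move\<^sup>*\<^sup>* D0 D}"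

text \<open>
  A labeling of \<open>D\<close> is represented by a total function on cells, of which only the values on \<open>D\<close>
  are ever used.
\<close>

type_synonym labeling = "cell \<Rightarrow> nat"

definition is_labeling :: "cell set \<Rightarrow> labeling \<Rightarrow> bool" where
  "is_labeling D L \<longleftrightarrow> (\<forall>x \<in> D. 1 \<le> L x)"

definition strict_labeling :: "cell set \<Rightarrow> labeling \<Rightarrow> bool" where
  "strict_labeling D L \<longleftrightarrow> is_labeling D L \<and>
    (\<forall>r r' c. (r, c) \<in> D \<and> (r', c) \<in> D \<and> r < r' \<longrightarrow> L (r, c) < L (r', c))"

definition super_standard :: labeling where
  "super_standard = fst"

definition column_content :: "cell set \<Rightarrow> labeling \<Rightarrow> nat \<Rightarrow> nat set" where
  "column_content D L i = {L (r, i) | r. (r, i) \<in> D}"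

definition column_equivalent :: "cell set \<Rightarrow> labeling \<Rightarrow> cell set \<Rightarrow> labeling \<Rightarrow> bool" where
  "column_equivalent D L D' L' \<longleftrightarrow>
    strict_labeling D L \<and> strict_labeling D' L' \<and>
    (\<forall>i \<ge> 1. column_content D L i = column_content D' L' i)"

definition northeast_labeling :: "cell set \<Rightarrow> labeling \<Rightarrow> bool" where
  "northeast_labeling D L \<longleftrightarrow>
    strict_labeling D L \<and>
    (\<forall>r c. (r, c) \<in> D \<longrightarrow> r \<le> L (r, c)) \<and>
    (\<forall>r c r' c'. (r, c) \<in> D \<and> (r', c') \<in> D \<and> c < c' \<and> L (r', c') < L (r, c) \<longrightarrow>
      (\<exists>r''. (r'', c') \<in> D \<and> L (r'', c') = L (r, c))) \<and>
    (\<forall>r c r' c'. (r, c) \<in> D \<and> (r', c') \<in> D \<and> c < c' \<and> L (r', c') = L (r, c) \<longrightarrow> r' \<le> r)"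

end

theory Submission
  imports Defs
begin

text \<open>
  A strict labeling with the column content of the super-standard labeling of \<open>D0\<close> records, for each
  cell of \<open>D\<close>, the row of \<open>D0\<close> it started from; condition (3) of a northeast labeling then only says
  that \<open>D0\<close> is northeast. A Kohnert move lowers by one the labels of a run of consecutive cells in
  one column. This could violate condition (4) only against a column to the right having the same
  label in the same row; by (3) the two columns then agree up to the top of the run, so that its
  top cell would not be rightmost in its row. Conversely, if some cell lies strictly below its
  label, take the leftmost such cell in the highest possible row: raising it by one row keeps all
  conditions and is inverse to a Kohnert move.
\<close>

text \<open>This packages northeast labeling and column equivalence: the two clauses mentioning
  \<open>D0\<close> say that the labels in each column are exactly the rows of \<open>D0\<close>
  there. Condition (3) is recovered from these clauses and the northeastness of \<open>D0\<close> in
  \<open>lowered_iff\<close>.\<close>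

definition lowered :: "cell set \<Rightarrow> cell set \<Rightarrow> labeling \<Rightarrow> bool" where
  "lowered D0 D L \<longleftrightarrow>
    diagram D \<and>
    (\<forall>r c. (r, c) \<in> D \<longrightarrow> r \<le> L (r, c) \<and> (L (r, c), c) \<in> D0) \<and>
    (\<forall>i c. (i, c) \<in> D0 \<longrightarrow> (\<exists>r. (r, c) \<in> D \<and> L (r, c) = i)) \<and>
    (\<forall>r r' c. (r, c) \<in> D \<and> (r', c) \<in> D \<and> r < r' \<longrightarrow> L (r, c) < L (r', c)) \<and>
    (\<forall>r c r' c'. (r, c) \<in> D \<and> (r', c') \<in> D \<and> c < c' \<and> L (r', c') = L (r, c) \<longrightarrow> r' \<le> r)"

lemma
  assumes "lowered D0 D L"
  shows lowered_diagram: "diagram D"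
    and lowered_le: "(r, c) \<in> D \<Longrightarrow> r \<le> L (r, c)"
    and lowered_label: "(r, c) \<in> D \<Longrightarrow> (L (r, c), c) \<in> D0"
    and lowered_cell: "(i, c) \<in> D0 \<Longrightarrow> \<exists>r. (r, c) \<in> D \<and> L (r, c) = i"
    and lowered_strict: "(r, c) \<in> D \<Longrightarrow> (r', c) \<in> D \<Longrightarrow> r < r' \<Longrightarrow> L (r, c) < L (r', c)"
    and lowered_below:
      "(r, c) \<in> D \<Longrightarrow> (r', c') \<in> D \<Longrightarrow> c < c' \<Longrightarrow> L (r', c') = L (r, c) \<Longrightarrow> r' \<le> r"
  using assms unfolding lowered_def by blast+

lemma northeastD:
  assumes "northeast D" "(a, c) \<in> D" "(b, k) \<in> D" "c < k" "b < a"
  shows "(a, k) \<in> D"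
proof -
  have "(max a b, max c k) \<in> D"
    using assms(1-3) unfolding northeast_def by blast
  then show ?thesis using assms(4,5) by (simp add: max_def)
qed

lemma diagram_pos: "diagram D \<Longrightarrow> (r, c) \<in> D \<Longrightarrow> 1 \<le> r \<and> 1 \<le> c"
  unfolding diagram_def by auto

lemma lowered_refl: "diagram D0 \<Longrightarrow> lowered D0 D0 super_standard"
  unfolding lowered_def super_standard_def by auto

lemma lowered_reflect_less:
  assumes "lowered D0 D L" "(r, c) \<in> D" "(r', c) \<in> D" "L (r, c) < L (r', c)"
  shows "r < r'"
  using lowered_strict[OF assms(1,3,2)] assms(4) by (metis less_asym nat_neq_iff)

lemma lowered_iff:
  assumes "diagram D0" "northeast D0" "diagram D"
  shows "lowered D0 D L \<longleftrightarrow>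
    northeast_labeling D L \<and> column_equivalent D L D0 super_standard"
proof
  assume low: "lowered D0 D L"
  have pos: "1 \<le> L (r, c)" if "(r, c) \<in> D" for r c
    using lowered_le[OF low that] diagram_pos[OF assms(3) that] by simp
  have strict: "strict_labeling D L"
    unfolding strict_labeling_def is_labeling_def
    using pos lowered_strict[OF low] by fast
  have strict0: "strict_labeling D0 super_standard"
    unfolding strict_labeling_def is_labeling_def super_standard_def
    using diagram_pos[OF assms(1)] by auto
  \<comment> \<open>Both labels are rows of \<open>D0\<close> in their columns, so northeastness
    puts the larger one into column \<open>c'\<close> of \<open>D0\<close>; hence it is a label in
    that column of \<open>D\<close>.\<close>
  have three: "\<exists>r''. (r'', c') \<in> D \<and> L (r'', c') = L (r, c)"
    if "(r, c) \<in> D" "(r', c') \<in> D" "c < c'" "L (r', c') < L (r, c)" for r c r' c'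
    by (rule lowered_cell[OF low], rule northeastD[OF assms(2)
        lowered_label[OF low that(1)] lowered_label[OF low that(2)] that(3,4)])
  have content: "column_content D L i = column_content D0 super_standard i" for i
    unfolding column_content_def super_standard_def
    using lowered_label[OF low] lowered_cell[OF low] by fastforce
  have "northeast_labeling D L"
    unfolding northeast_labeling_def
    using strict three lowered_le[OF low] lowered_below[OF low] by blast
  then show "northeast_labeling D L \<and> column_equivalent D L D0 super_standard"
    using strict strict0 content unfolding column_equivalent_def by blast
next
  assume "northeast_labeling D L \<and> column_equivalent D L D0 super_standard"
  then have ne: "northeast_labeling D L"
    and ce: "column_equivalent D L D0 super_standard" by auto
  have content: "{L (r, c) | r. (r, c) \<in> D} = {i. (i, c) \<in> D0}" if "1 \<le> c" for c
    using ce that unfolding column_equivalent_def column_content_def super_standard_def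
    by auto
  have label: "(L (r, c), c) \<in> D0" if "(r, c) \<in> D" for r c
    using content[of c] diagram_pos[OF assms(3) that] that by blast
  have cell: "\<exists>r. (r, c) \<in> D \<and> L (r, c) = i" if "(i, c) \<in> D0" for i c
  proof -
    have "i \<in> {L (r, c) | r. (r, c) \<in> D}"
      using content[of c] diagram_pos[OF assms(1) that] that by simp
    then show ?thesis by blast
  qed
  show "lowered D0 D L"
    using ne label cell assms(3)
    unfolding lowered_def northeast_labeling_def strict_labeling_def by blast
qed

text \<open>The next label up in column \<open>c\<close> exceeds the one reached in column
  \<open>k\<close>, so northeastness makes it a label of column \<open>k\<close> too. Condition (4)
  bounds its row from above by the row in column \<open>c\<close>, and strictness puts it above the
  cell reached before; one row remains.\<close>

lemma lowered_run:
  assumes low: "lowered D0 D L" and ne: "northeast D0" and "c < k"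
    and "(s, k) \<in> D" "L (s, k) = L (s, c)"
    and "\<And>u. s \<le> u \<Longrightarrow> u \<le> s + t \<Longrightarrow> (u, c) \<in> D"
  shows "(s + t, k) \<in> D \<and> L (s + t, k) = L (s + t, c)"
  using assms(6)
proof (induction t)
  case 0
  then show ?case using assms(4,5) by simp
next
  case (Suc t)
  then have IH: "(s + t, k) \<in> D" "L (s + t, k) = L (s + t, c)" by auto
  have c: "(s + t, c) \<in> D" "(s + Suc t, c) \<in> D" using Suc.prems by auto
  have less: "L (s + t, k) < L (s + Suc t, c)"
    using lowered_strict[OF low c] IH(2) by simp
  have "(L (s + Suc t, c), k) \<in> D0"
    by (rule northeastD[OF ne lowered_label[OF low c(2)] lowered_label[OF low IH(1)] \<open>c < k\<close> less])
  then obtain u where u: "(u, k) \<in> D" "L (u, k) = L (s + Suc t, c)"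
    using lowered_cell[OF low] by blast
  have "u \<le> s + Suc t" by (rule lowered_below[OF low c(2) u(1) \<open>c < k\<close> u(2)])
  moreover have "s + t < u"
    by (rule lowered_reflect_less[OF low IH(1) u(1)]) (use less u(2) in simp)
  ultimately have "u = s + Suc t" by simp
  then show ?case using u by simp
qed

lemma lowered_kohnert_move:
  assumes low: "lowered D0 D L" and ne: "northeast D0" and "kohnert_move D D'"
  shows "\<exists>L'. lowered D0 D' L'"
proof -
  obtain r c q where right: "rightmost_in_row D r c"
    and q: "q \<in> empty_rows_below D r c" "\<forall>s \<in> empty_rows_below D r c. s \<le> q"
    and D': "D' = insert (q, c) (D - {(r, c)})"
    using assms(3) unfolding kohnert_move_def by blast
  have rD: "(r, c) \<in> D" and rmax: "\<And>k. (r, k) \<in> D \<Longrightarrow> k \<le> c"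
    using right unfolding rightmost_in_row_def by auto
  have q1: "1 \<le> q" "q < r" "(q, c) \<notin> D"
    using q(1) unfolding empty_rows_below_def by auto
  have run: "(u, c) \<in> D" if "q < u" "u \<le> r" for u
  proof (rule ccontr)
    assume "(u, c) \<notin> D"
    moreover from this rD that(2) have "u < r" by (metis le_neq_implies_less)
    ultimately have "u \<in> empty_rows_below D r c"
      using that q1 unfolding empty_rows_below_def by simp
    then show False using q(2) that(1) by fastforce
  qed
  \<comment> \<open>\<open>old u k\<close> is the row of \<open>D\<close> whose label passes to
    \<open>(u, k)\<close>. Carrying the label of \<open>(r, c)\<close> alone down to row
    \<open>q\<close> would break strictness when \<open>q < r - 1\<close>, so every label in rows
    \<open>q + 1\<close> to \<open>r\<close> drops by one row instead.\<close>
  define old where "old u k = (if k = c \<and> q \<le> u \<and> u < r then Suc u else u)" for u k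
  define L' where "L' x = L (old (fst x) (snd x), snd x)" for x
  have L': "L' (u, k) = L (old u k, k)" for u k by (simp add: L'_def)
  have old_D: "(old u k, k) \<in> D" if "(u, k) \<in> D'" for u k
    using that run[of "Suc u"] q1 unfolding D' old_def by (auto split: if_splits)
  have old_ge: "u \<le> old u k" for u k by (simp add: old_def)
  have old_mono: "old u k < old v k" if "(u, k) \<in> D'" "(v, k) \<in> D'" "u < v" for u v k
    using that q1 unfolding D' old_def by auto
  have old_surj: "\<exists>v. (v, k) \<in> D' \<and> old v k = u" if "(u, k) \<in> D" for u k
  proof (cases "k = c \<and> q < u \<and> u \<le> r")
    case True
    then have "(u - 1, k) \<in> D'" using run[of "u - 1"] q1 unfolding D'
      by (cases "u - 1 = q") auto
    moreover have "old (u - 1) k = u" using True by (auto simp: old_def)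
    ultimately show ?thesis by blast
  next
    case False
    then have "(u, k) \<in> D'" using that q1 unfolding D' by auto
    moreover have "old u k = u" using False that q1
      unfolding old_def by (auto simp: le_less)
    ultimately show ?thesis by blast
  qed
  have "diagram D'"
    using lowered_diagram[OF low] q1(1) diagram_pos[OF lowered_diagram[OF low] rD]
    unfolding diagram_def D' by auto
  moreover have "u \<le> L' (u, k) \<and> (L' (u, k), k) \<in> D0" if "(u, k) \<in> D'" for u k
    using lowered_le[OF low old_D[OF that]] lowered_label[OF low old_D[OF that]] old_ge[of u k]
    by (simp add: L')
  moreover have "\<exists>u. (u, k) \<in> D' \<and> L' (u, k) = i" if "(i, k) \<in> D0" for i k
    using lowered_cell[OF low that] old_surj L' by metis
  moreover have "L' (u, k) < L' (v, k)" if "(u, k) \<in> D'" "(v, k) \<in> D'" "u < v" for u v k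
    using lowered_strict[OF low old_D[OF that(1)] old_D[OF that(2)] old_mono[OF that]]
    by (simp add: L')
  moreover have "v \<le> u"
    if uD: "(u, j) \<in> D'" and vD: "(v, k) \<in> D'" and jk: "j < k" and eq: "L' (v, k) = L' (u, j)"
    for u j v k
  proof (rule ccontr)
    assume "\<not> v \<le> u"
    have le: "old v k \<le> old u j"
      using lowered_below[OF low old_D[OF uD] old_D[OF vD] jk] eq by (simp add: L')
    \<comment> \<open>A violation needs the left label to have dropped:
      \<open>u < v \<le> old v k \<le> old u j\<close> leaves only \<open>old u j = Suc u\<close>,
      which happens only in column \<open>c\<close> from row \<open>q\<close> to below row
      \<open>r\<close>.\<close>
    then have j: "j = c" "q \<le> u" "u < r" and old_v: "old v k = Suc u"
      using \<open>\<not> v \<le> u\<close> old_ge[of v k] unfolding old_def by (auto split: if_splits)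
    \<comment> \<open>The equal labels in row \<open>Suc u\<close> propagate up the filled run to
      row \<open>r\<close>, giving a cell to the right of the rightmost one.\<close>
    have "(Suc u + (r - Suc u), k) \<in> D"
      by (rule lowered_run[OF low ne, of c, THEN conjunct1])
        (use j jk old_v old_D[OF vD] eq run in \<open>auto simp: L' old_def\<close>)
    then show False using rmax[of k] j jk by simp
  qed
  ultimately have "lowered D0 D' L'" unfolding lowered_def by blast
  then show ?thesis by blast
qed

text \<open>This undoes one Kohnert move. Taking the highest row with a displaced cell makes every
  cell above it carry its own row as label, which empties row \<open>Suc s\<close> from column
  \<open>c\<close> rightwards; taking the leftmost such cell protects condition (4).\<close>

lemma lowered_raise:
  assumes low: "lowered D0 D L" and ne: "northeast D0" and "D \<noteq> D0"
  obtains s c where "(s, c) \<in> D" "s < L (s, c)" "(Suc s, c) \<notin> D"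
    "kohnert_move (insert (Suc s, c) (D - {(s, c)})) D"
    "lowered D0 (insert (Suc s, c) (D - {(s, c)})) (L((Suc s, c) := L (s, c)))"
proof -
  define S where "S = {s. \<exists>c. (s, c) \<in> D \<and> s < L (s, c)}"
  \<comment> \<open>With no displaced cell, \<open>L\<close> is the row index on \<open>D\<close>,
    and the column contents force \<open>D = D0\<close>.\<close>
  have "S \<noteq> {}"
  proof
    assume "S = {}"
    then have diag: "L (r, c) = r" if "(r, c) \<in> D" for r c
      using that lowered_le[OF low that] unfolding S_def by fastforce
    have "x \<in> D \<longleftrightarrow> x \<in> D0" for x
      using lowered_label[OF low] lowered_cell[OF low] diag by (cases x) metis
    then show False using \<open>D \<noteq> D0\<close> by blast
  qed
  moreover have "finite S"
  proof (rule finite_subset)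
    show "S \<subseteq> fst ` D" unfolding S_def by force
    show "finite (fst ` D)" using lowered_diagram[OF low] unfolding diagram_def by simp
  qed
  ultimately have "Max S \<in> S" and Smax: "\<And>s. s \<in> S \<Longrightarrow> s \<le> Max S" by auto
  define s where "s = Max S"
  define c where "c = (LEAST c. (s, c) \<in> D \<and> s < L (s, c))"
  have "\<exists>c. (s, c) \<in> D \<and> s < L (s, c)" using \<open>Max S \<in> S\<close> unfolding S_def s_def by blast
  then have sD: "(s, c) \<in> D" and disp: "s < L (s, c)"
    unfolding c_def by (metis (mono_tags, lifting) LeastI_ex)+
  have left: "c \<le> k" if "(s, k) \<in> D" "s < L (s, k)" for k
    unfolding c_def using that by (simp add: Least_le)
  have above: "L (u, k) = u" if "(u, k) \<in> D" "s < u" for u k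
  proof (rule ccontr)
    assume "L (u, k) \<noteq> u"
    then have "u \<in> S" using lowered_le[OF low that(1)] that(1) unfolding S_def by force
    then show False using Smax[of u] that(2) s_def by simp
  qed
  have empty: "(Suc s, c) \<notin> D"
    using lowered_strict[OF low sD, of "Suc s"] above[of "Suc s" c] disp by force
  have right: "(Suc s, k) \<notin> D" if "c < k" for k
  proof
    assume k: "(Suc s, k) \<in> D"
    have Lk: "L (Suc s, k) = Suc s" using above[OF k] by simp
    \<comment> \<open>\<open>L (s, c)\<close> is at least \<open>Suc s\<close>, the label of the
      supposed cell, so it occurs in column \<open>k\<close> as well; equality is split off because
      \<open>northeastD\<close> asks for a strict inequality. By (4) it occurs in row
      \<open>s\<close> or lower, beneath the label \<open>Suc s\<close>, against strictness.\<close>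
    have "(L (s, c), k) \<in> D0"
    proof (cases "L (s, c) = Suc s")
      case True
      then show ?thesis using lowered_label[OF low k] Lk by simp
    next
      case False
      then show ?thesis
        using northeastD[OF ne lowered_label[OF low sD] lowered_label[OF low k] that] Lk disp
        by simp
    qed
    then obtain u where u: "(u, k) \<in> D" "L (u, k) = L (s, c)" using lowered_cell[OF low] by blast
    have "u \<le> s" by (rule lowered_below[OF low sD u(1) that u(2)])
    then have "L (u, k) < Suc s" using lowered_strict[OF low u(1) k] Lk by simp
    then show False using u(2) disp by simp
  qed
  have s1: "1 \<le> s" "1 \<le> c" using diagram_pos[OF lowered_diagram[OF low] sD] by auto
  define E where "E = insert (Suc s, c) (D - {(s, c)})"
  define M where "M = L((Suc s, c) := L (s, c))"
  have "rightmost_in_row E (Suc s) c"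
    unfolding rightmost_in_row_def E_def using right by (auto simp: not_less[symmetric])
  moreover have "s \<in> empty_rows_below E (Suc s) c"
    "\<forall>t \<in> empty_rows_below E (Suc s) c. t \<le> s"
    unfolding empty_rows_below_def E_def using s1 by auto
  moreover have "D = insert (s, c) (E - {(Suc s, c)})"
    unfolding E_def using sD empty by auto
  ultimately have move: "kohnert_move E D" unfolding kohnert_move_def by blast
  have "diagram E"
    using lowered_diagram[OF low] s1 unfolding diagram_def E_def by auto
  moreover have "u \<le> M (u, k) \<and> (M (u, k), k) \<in> D0" if "(u, k) \<in> E" for u k
    using that disp lowered_label[OF low sD] lowered_le[OF low, of u k]
      lowered_label[OF low, of u k] empty
    unfolding E_def M_def by auto
  moreover have "\<exists>u. (u, k) \<in> E \<and> M (u, k) = i" if i: "(i, k) \<in> D0" for i k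
  proof -
    obtain u where u: "(u, k) \<in> D" "L (u, k) = i" using lowered_cell[OF low i] by blast
    show ?thesis
    proof (cases "(u, k) = (s, c)")
      case True
      then show ?thesis using u unfolding E_def M_def by auto
    next
      case False
      then show ?thesis using u empty unfolding E_def M_def by (intro exI[of _ u]) auto
    qed
  qed
  moreover have "M (u, k) < M (v, k)" if uv: "(u, k) \<in> E" "(v, k) \<in> E" "u < v" for u v k
  proof -
    consider "(u, k) = (Suc s, c)" | "(v, k) = (Suc s, c)"
      | "(u, k) \<noteq> (Suc s, c)" "(v, k) \<noteq> (Suc s, c)" by blast
    then show ?thesis
    proof cases
      case 1
      then show ?thesis using uv lowered_strict[OF low sD, of v] unfolding E_def M_def by auto
    next
      case 2
      then have "(u, c) \<in> D" "u < s" "k = c" using uv unfolding E_def by auto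
      then show ?thesis using 2 lowered_strict[OF low _ sD, of u] unfolding M_def by auto
    next
      case 3
      then show ?thesis using uv lowered_strict[OF low, of u k v] unfolding E_def M_def by auto
    qed
  qed
  moreover have "v \<le> u"
    if uv: "(u, j) \<in> E" "(v, k) \<in> E" "j < k" "M (v, k) = M (u, j)" for u j v k
  proof -
    consider "(u, j) = (Suc s, c)" | "(v, k) = (Suc s, c)"
      | "(u, j) \<noteq> (Suc s, c)" "(v, k) \<noteq> (Suc s, c)" by blast
    then show ?thesis
    proof cases
      case 1
      then have "(v, k) \<in> D" "c < k" "L (v, k) = L (s, c)" using uv unfolding E_def M_def by auto
      then show ?thesis using 1 lowered_below[OF low sD] by fastforce
    next
      case 2
      then have u: "(u, j) \<in> D" "j < c" "L (s, c) = L (u, j)"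
        using uv unfolding E_def M_def by auto
      have "s \<le> u" by (rule lowered_below[OF low u(1) sD u(2,3)])
      \<comment> \<open>Otherwise \<open>(s, j)\<close> would be a displaced cell of row
        \<open>s\<close> to the left of column \<open>c\<close>.\<close>
      moreover have "u \<noteq> s" using left[of j] u disp by auto
      ultimately show ?thesis using 2 by simp
    next
      case 3
      then show ?thesis using uv lowered_below[OF low, of u j v k] unfolding E_def M_def by auto
    qed
  qed
  ultimately have "lowered D0 E M" unfolding lowered_def by blast
  then show ?thesis using that[OF sD disp empty] move unfolding E_def M_def by blast
qed

text \<open>The induction is on the total displacement of the cells from their labels, which drops
  by one with each raise; the truncated differences are genuine by
  \<open>lowered_le\<close>.\<close>

lemma lowered_reachable:
  assumes "northeast D0" "lowered D0 D L"
  shows "kohnert_move\<^sup>*\<^sup>* D0 D"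
  using assms(2)
proof (induction "\<Sum>x\<in>D. L x - fst x" arbitrary: D L rule: less_induct)
  case less
  show ?case
  proof (cases "D = D0")
    case True
    then show ?thesis by simp
  next
    case False
    obtain s c where s: "(s, c) \<in> D" "s < L (s, c)" "(Suc s, c) \<notin> D"
      and move: "kohnert_move (insert (Suc s, c) (D - {(s, c)})) D"
      and low: "lowered D0 (insert (Suc s, c) (D - {(s, c)})) (L((Suc s, c) := L (s, c)))"
      by (rule lowered_raise[OF less.prems assms(1) False])
    let ?M = "L((Suc s, c) := L (s, c))"
    have fin: "finite D" using lowered_diagram[OF less.prems] unfolding diagram_def by simp
    \<comment> \<open>The remaining cells do not see the update of \<open>L\<close>, since
      \<open>(Suc s, c)\<close> is not in \<open>D\<close>.\<close>
    have "(\<Sum>x\<in>D - {(s, c)}. ?M x - fst x) = (\<Sum>x\<in>D - {(s, c)}. L x - fst x)"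
      by (rule sum.cong) (use s(3) in auto)
    then have "(\<Sum>x\<in>insert (Suc s, c) (D - {(s, c)}). ?M x - fst x)
        = (L (s, c) - Suc s) + (\<Sum>x\<in>D - {(s, c)}. L x - fst x)"
      using fin s(3) by simp
    also have "\<dots> < (L (s, c) - s) + (\<Sum>x\<in>D - {(s, c)}. L x - fst x)"
      using s(2) by simp
    also have "\<dots> = (\<Sum>x\<in>D. L x - fst x)"
      using sum.remove[OF fin s(1), of "\<lambda>x. L x - fst x"] by simp
    finally have "kohnert_move\<^sup>*\<^sup>* D0 (insert (Suc s, c) (D - {(s, c)}))"
      using less.hyps low by blast
    then show ?thesis using move by (rule rtranclp.rtrancl_into_rtrancl)
  qed
qed

lemma reachable_lowered:
  assumes "diagram D0" "northeast D0" "kohnert_move\<^sup>*\<^sup>* D0 D"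
  shows "\<exists>L. lowered D0 D L"
  using assms(3)
  by (induction rule: rtranclp_induct)
    (use lowered_refl[OF assms(1)] lowered_kohnert_move[OF _ assms(2)] in blast)+

theorem theorem2p16:
  fixes D0 D :: "cell set"
  assumes "diagram D0" and "northeast D0" and "diagram D"
  shows "D \<in> kohnert_diagrams D0 \<longleftrightarrow>
    (\<exists>L. northeast_labeling D L \<and> column_equivalent D L D0 super_standard)"
  unfolding kohnert_diagrams_def lowered_iff[OF assms, symmetric]
  using reachable_lowered[OF assms(1,2)] lowered_reachable[OF assms(2)] by blast

end
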